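(* Let $n\in\mathbb{N}$, $\Omega=\mathbb{R}^n$, $T\in(0,\infty)$ and $\alpha\in(0,1]$. Let $a_{ij},b_i:\overline{\Omega}_T\to\mathbb{R}$ ($i,j=1,\dots,n$) satisfy: (a) $a_{ij},b_i\in L^\infty(\overline\Omega_T)\cap H_\alpha(\overline\Omega_T)$ for all $i,j$, and $a_{ij}=a_{ji}$ on $\Omega_T$; (b) there are constants $A_{\min},A_{\max}>0$ such that $A_{\min}|\eta|^2\le\sum_{i,j=1}^n a_{ij}(x,t)\eta_i\eta_j\le A_{\max}|\eta|^2$ for all $(x,t)\in\overline\Omega_T$, $\eta\in\mathbb{R}^n$; (c) there is a constant $k_\alpha>0$ such that $|a_{ij}(x_1,t_1)-a_{ij}(x_2,t_2)|\le k_\alpha\big(|x_1-x_2|^\alpha+|t_1-t_2|^{\alpha/2}\big)$ for all $(x_1,t_1),(x_2,t_2)\in\overline\Omega_T$ and all $i,j$; (d) the derivatives $\partial_{x_kx_l}a_{ij}$, $\partial_{x_k}a_{ij}$, $\partial_{x_k}b_i$ exist and belong to $L^\infty(\overline\Omega_T)\cap H_\alpha(\overline\Omega_T)$ for all $i,j,k,l\in\{1,\dots,n\}$. Let $f:\Omega_T\times\mathbb{R}^2\to\mathbb{R}$, let $\phi\in L^1(\Omega)$ with $\phi\ge0$ on $\Omega$, let $Ju(x,t)=\int_{\Omega}\phi(x-y)u(y,t)\,dy$, and let $P$ be the operator $$P[u]=\sum_{i,j=1}^n a_{ij}\,\partial_{x_ix_j}u+\sum_{i=1}^n b_i\,\partial_{x_i}u+f(\cdot,u,Ju)-\partial_t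 u\qquad\text{on }\Omega_T .$$ Let $\overline u,\underline u\in \mathcal{C}(\overline{\Omega}_T)\cap \mathcal{C}^{2,1}(\Omega_T)\cap L^\infty(\overline{\Omega}_T)$ and let $$\mathcal{K}=\Big[\inf_{\overline\Omega_T}\min\{\overline u,\underline u\},\ \sup_{\overline\Omega_T}\max\{\overline u,\underline u\}\Big]\times\Big[\inf_{\overline\Omega_T}\min\{J\overline u,J\underline u\},\ \sup_{\overline\Omega_T}\max\{J\overline u,J\underline u\}\Big].$$ Suppose that $f=f(x,t,u,v)$ is non-decreasing with respect to $v$ (the argument in which $Ju$ is inserted) on $\Omega_T\times\mathcal{K}$, and that $f$ satisfies Lipschitz conditions in $u$ and in $v$ on $\Omega_T\times\mathcal{K}$. Suppose furthermore that $$P[\overline u]\le P[\underline u]\quad\text{on }\Omega_T\qquad\text{and}\qquad \overline u\ge\underline u\quad\text{on }\partial\Omega_T .$$ Then $\overline u\ge\underline u$ on $\overline\Omega_T$.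
   Context: Notation (with $\Omega=\mathbb{R}^n$): $\Omega_T=\mathbb{R}^n\times(0,T]$; $\partial\Omega_T=\mathbb{R}^n\times\{0\}$ (the parabolic boundary); $\overline{\Omega}_T=\mathbb{R}^n\times[0,T]$. $|\cdot|$ is the Euclidean norm on $\mathbb{R}^n$. $\mathcal{C}(X)$ is the set of continuous real-valued functions on $X$. $\mathcal{C}^{2,1}(\Omega_T)$ is the set of continuous $u:\Omega_T\to\mathbb{R}$ whose spatial partial derivatives up to order $2$ (including mixed ones) and first time derivative $\partial_t u$ exist and are continuous on $\Omega_T$ (at $t=T$ the time derivative is one-sided). $L^\infty(X)$ denotes the (essentially) bounded real-valued functions on $X$. $H_\alpha(X)$ is the set of all $u\in\mathcal{C}(X)$ for which there is a constant $k>0$ with $|u(x_1,t)-u(x_2,t)|\le k|x_1-x_2|^\alpha$ for all $(x_1,t),(x_2,t)\in X$. In $P[u]$, $f(\cdot,u,Ju)$ denotes $(x,t)\mapsto f(x,t,u(x,t),Ju(x,t))$. The formula for $Ju$ is used at all points of $\overline{\Omega}_T$. For $\mathcal{K}\subseteq\mathbb{R}^2$: - $f$ satisfies a Lipschitz condition in $u$ on $\Omega_T\times\mathcal{K}$ if there is a constant $k\ge0$ with $|f(x,t,u_1,v)-f(x,t,u_2,v)|\le k|u_1-u_2|$ for all $(x,t)\in\Omega_T$ and $(u_1,v),(u_2,v)\in\mathcal{K}$. - $f$ satisfies a Lipschitz condition in $v$ on $\Omega_T\times\mathcal{K}$ if there is a constant $k\ge0$ with $|f(x,t,u,v_1)-f(x,t,u,v_2)|\le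 k|v_1-v_2|$ for all $(x,t)\in\Omega_T$ and $(u,v_1),(u,v_2)\in\mathcal{K}$. - $f$ is non-decreasing with respect to $v$ on $\Omega_T\times\mathcal{K}$ if $f(x,t,u,v_1)\le f(x,t,u,v_2)$ for all $(x,t)\in\Omega_T$ and $(u,v_1),(u,v_2)\in\mathcal{K}$ with $v_1\le v_2$. *)

theory Defs
  imports "HOL-Analysis.Analysis"
begin

text \<open>
  Space-time points are pairs in \<^typ>\<open>(real^'n) \<times> real\<close>. Functions on a subset of space-time
  are total functions of which only the values on that subset matter.
\<close>

definition cyl :: "real \<Rightarrow> ((real^'n) \<times> real) set" where
  "cyl T = UNIV \<times> {0<..T}"

definition closed_cyl :: "real \<Rightarrow> ((real^'n) \<times> real) set" where
  "closed_cyl T = UNIV \<times> {0..T}"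

definition parabolic_boundary :: "((real^'n) \<times> real) set" where
  "parabolic_boundary = UNIV \<times> {0}"

text \<open>
  Genuinely bounded functions. This space is only ever intersected with spaces of functions
  continuous on \<^term>\<open>closed_cyl T\<close>, for which essential boundedness is the same.
\<close>

definition L_infty :: "'a set \<Rightarrow> ('a \<Rightarrow> real) set" where
  "L_infty X = {u. bounded (u ` X)}"

text \<open>Hoelder continuity in the space variable only, uniformly in time.\<close>

definition H_space :: "real \<Rightarrow> ((real^'n) \<times> real) set \<Rightarrow> ((real^'n) \<times> real \<Rightarrow> real) set" where
  "H_space \<alpha> X = {u. continuous_on X u \<and>
     (\<exists>k>0. \<forall>x1 x2 t. (x1, t) \<in> X \<longrightarrow> (x2, t) \<in> X \<longrightarrow>
        \<bar>u (x1, t) - u (x2, t)\<bar> \<le> k * norm (x1 - x2) powr \<alpha>)}"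

definition has_dx_on :: "'n \<Rightarrow> ((real^'n) \<times> real \<Rightarrow> real) \<Rightarrow> ((real^'n) \<times> real) set \<Rightarrow> bool" where
  "has_dx_on i u X \<longleftrightarrow>
     (\<forall>(x, t)\<in>X. (\<lambda>s. u (x + s *\<^sub>R axis i 1, t)) differentiable (at 0))"

definition dx :: "'n \<Rightarrow> ((real^'n) \<times> real \<Rightarrow> real) \<Rightarrow> (real^'n) \<times> real \<Rightarrow> real" where
  "dx i u = (\<lambda>(x, t). deriv (\<lambda>s. u (x + s *\<^sub>R axis i 1, t)) 0)"

text \<open>
  Time derivatives are taken within \<open>(0, T]\<close>: two-sided for \<open>t < T\<close>, one-sided at \<open>t = T\<close>.
\<close>

definition has_dt_on_cyl :: "real \<Rightarrow> ((real^'n) \<times> real \<Rightarrow> real) \<Rightarrow> bool" where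
  "has_dt_on_cyl T u \<longleftrightarrow>
     (\<forall>(x, t)\<in>cyl T. (\<lambda>s. u (x, s)) differentiable (at t within {0<..T}))"

definition dt :: "real \<Rightarrow> ((real^'n) \<times> real \<Rightarrow> real) \<Rightarrow> (real^'n) \<times> real \<Rightarrow> real" where
  "dt T u = (\<lambda>(x, t). vector_derivative (\<lambda>s. u (x, s)) (at t within {0<..T}))"

definition C21 :: "real \<Rightarrow> ((real^'n) \<times> real \<Rightarrow> real) set" where
  "C21 T = {u. continuous_on (cyl T) u \<and>
     (\<forall>i. has_dx_on i u (cyl T) \<and> continuous_on (cyl T) (dx i u)) \<and>
     (\<forall>i j. has_dx_on i (dx j u) (cyl T) \<and> continuous_on (cyl T) (dx i (dx j u))) \<and>
     has_dt_on_cyl T u \<and> continuous_on (cyl T) (dt T u)}"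

definition J_op :: "(real^'n \<Rightarrow> real) \<Rightarrow> ((real^'n) \<times> real \<Rightarrow> real) \<Rightarrow> (real^'n) \<times> real \<Rightarrow> real" where
  "J_op \<phi> u = (\<lambda>(x, t). LINT y|lebesgue. \<phi> (x - y) * u (y, t))"

definition P_op ::
  "real \<Rightarrow> ('n \<Rightarrow> 'n \<Rightarrow> (real^'n) \<times> real \<Rightarrow> real) \<Rightarrow> ('n \<Rightarrow> (real^'n) \<times> real \<Rightarrow> real) \<Rightarrow>
   (real^'n \<Rightarrow> real \<Rightarrow> real \<Rightarrow> real \<Rightarrow> real) \<Rightarrow> (real^'n \<Rightarrow> real) \<Rightarrow>
   ((real^'n) \<times> real \<Rightarrow> real) \<Rightarrow> (real^'n) \<times> real \<Rightarrow> real" where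
  "P_op T a b f \<phi> u = (\<lambda>(x, t).
     (\<Sum>i\<in>UNIV. \<Sum>j\<in>UNIV. a i j (x, t) * dx i (dx j u) (x, t))
     + (\<Sum>i\<in>UNIV. b i (x, t) * dx i u (x, t))
     + f x t (u (x, t)) (J_op \<phi> u (x, t))
     - dt T u (x, t))"

text \<open>
  The infima and suprema below are those of the reals. They have their usual meaning for
  \<open>T \<ge> 0\<close>, integrable \<open>\<phi>\<close> and continuous bounded \<open>v\<close>, \<open>w\<close>, the four families being bounded then.
\<close>

definition K_rect ::
  "real \<Rightarrow> (real^'n \<Rightarrow> real) \<Rightarrow> ((real^'n) \<times> real \<Rightarrow> real) \<Rightarrow> ((real^'n) \<times> real \<Rightarrow> real) \<Rightarrow>
   (real \<times> real) set" where
  "K_rect T \<phi> v w =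
     {INF p\<in>closed_cyl T. min (v p) (w p) .. SUP p\<in>closed_cyl T. max (v p) (w p)} \<times>
     {INF p\<in>closed_cyl T. min (J_op \<phi> v p) (J_op \<phi> w p) ..
      SUP p\<in>closed_cyl T. max (J_op \<phi> v p) (J_op \<phi> w p)}"

definition lipschitz_in_u ::
  "((real^'n) \<times> real) set \<Rightarrow> (real \<times> real) set \<Rightarrow>
   (real^'n \<Rightarrow> real \<Rightarrow> real \<Rightarrow> real \<Rightarrow> real) \<Rightarrow> bool" where
  "lipschitz_in_u X K f \<longleftrightarrow> (\<exists>k\<ge>0. \<forall>(x, t)\<in>X. \<forall>u1 u2 v. (u1, v) \<in> K \<longrightarrow> (u2, v) \<in> K \<longrightarrow>
     \<bar>f x t u1 v - f x t u2 v\<bar> \<le> k * \<bar>u1 - u2\<bar>)"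

definition lipschitz_in_v ::
  "((real^'n) \<times> real) set \<Rightarrow> (real \<times> real) set \<Rightarrow>
   (real^'n \<Rightarrow> real \<Rightarrow> real \<Rightarrow> real \<Rightarrow> real) \<Rightarrow> bool" where
  "lipschitz_in_v X K f \<longleftrightarrow> (\<exists>k\<ge>0. \<forall>(x, t)\<in>X. \<forall>u v1 v2. (u, v1) \<in> K \<longrightarrow> (u, v2) \<in> K \<longrightarrow>
     \<bar>f x t u v1 - f x t u v2\<bar> \<le> k * \<bar>v1 - v2\<bar>)"

definition nondecreasing_in_v ::
  "((real^'n) \<times> real) set \<Rightarrow> (real \<times> real) set \<Rightarrow>
   (real^'n \<Rightarrow> real \<Rightarrow> real \<Rightarrow> real \<Rightarrow> real) \<Rightarrow> bool" where
  "nondecreasing_in_v X K f \<longleftrightarrow> (\<forall>(x, t)\<in>X. \<forall>u v1 v2. (u, v1) \<in> K \<longrightarrow> (u, v2) \<in> K \<longrightarrow>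
     v1 \<le> v2 \<longrightarrow> f x t u v1 \<le> f x t u v2)"

end

theory Submission
  imports Defs
begin

text \<open>
  The proof is a maximum principle for \<open>w = u - v\<close>, the upper function minus the lower one, in which the
  nonlocal term is treated as a perturbation of order zero. At a point where \<open>w \<le> 0\<close>, the Lipschitz
  conditions and the monotonicity of \<open>f\<close> in its last argument give
  \<open>f(\<cdot>, u, Ju) - f(\<cdot>, v, Jv) \<ge> - C * d\<close> as soon as \<open>w \<ge> - d\<close> on the whole time slice: monotonicity
  disposes of the part of \<open>Ju - Jv\<close> with the favourable sign, and the other part is at most
  \<open>d\<close> times the integral of \<open>\<phi>\<close> (\<open>reaction_difference_lower_bound\<close>). Hence \<open>w\<close> satisfies a linear
  differential inequality in which the nonlocality enters only through the infimum of a time slice.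

  Suppose now that \<open>w\<close> takes negative values. Put \<open>W = exp (- \<mu> t) * w\<close>, so that \<open>m = sup (- W)\<close>
  is finite and positive, and look at a minimum \<open>(z, t)\<close> of \<open>W + \<epsilon> * (1 + |x|\<^sup>2)\<close>. The penalty forces the
  minimum to be attained although space is unbounded, and for small \<open>\<epsilon>\<close> its value is below
  \<open>- m / 2\<close>. At this point the time derivative is at most zero (it may be one-sided, at the final
  time), the gradient vanishes and the second-order part is nonnegative; multiplying the
  differential inequality by \<open>exp (- \<mu> t)\<close> therefore bounds \<open>\<mu> * W\<close> from below by
  \<open>- C * m - \<epsilon> * K * (1 + |z|\<^sup>2)\<close>, where \<open>K\<close> depends only on the dimension and the coefficient bounds.
  On the other hand \<open>\<mu> * W\<close> is below \<open>- \<mu> * m / 2 - \<mu> * \<epsilon> * (1 + |z|\<^sup>2)\<close>, which is impossible for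
  \<open>\<mu> > K + 2 * C\<close>. The nonlocal term does no harm because it is controlled by \<open>m\<close>, the very
  quantity that the choice of \<open>\<mu>\<close> dominates.

  The second-order step (\<open>elliptic_sum_nonneg_at_minimum\<close>) has two ingredients: for a function with
  continuous partial derivatives up to order two the second derivative along every line is the
  quadratic form of the second partials, and the trace of the product of a positive definite
  symmetric matrix with a positive semidefinite form is nonnegative.
\<close>

section \<open>First and second derivatives at a minimum\<close>

lemma second_derivative_nonneg_at_minimum:
  fixes g g' :: "real \<Rightarrow> real"
  assumes g: "\<And>s. (g has_real_derivative g' s) (at s)"
    and g': "(g' has_real_derivative c) (at 0)"
    and min: "\<And>s. g 0 \<le> g s"
  shows "g' 0 = 0" and "0 \<le> c"
proof -
  show g'0: "g' 0 = 0"
    using DERIV_local_min[OF g, of 1 0] min by auto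
  show "0 \<le> c"
  proof (rule ccontr)
    assume "\<not> 0 \<le> c"
    then obtain d where d: "d > 0" "\<And>h. 0 < h \<Longrightarrow> h < d \<Longrightarrow> g' h < 0"
      using has_real_derivative_neg_dec_right[OF g'] g'0 by auto
    obtain z where "0 < z" "z < d / 2" "g (d / 2) - g 0 = (d / 2 - 0) * g' z"
      using MVT2[of 0 "d / 2" g g'] g d(1) by auto
    moreover have "g' z < 0"
      using d \<open>0 < z\<close> \<open>z < d / 2\<close> by simp
    ultimately have "g (d / 2) < g 0"
      using d(1) by (smt (verit) divide_pos_pos mult_pos_neg)
    with min show False
      by (meson not_less)
  qed
qed

text \<open>
  The reason is that \<open>a\<close> is a sum of rank-one matrices \<open>\<xi> \<xi>\<^sup>T\<close>, each of which pairs with \<open>h\<close> to the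
  value of the form \<open>h\<close> at \<open>\<xi>\<close>. Instead of diagonalising \<open>a\<close>, the induction splits off one such summand per
  index, as in Gaussian elimination: what remains is the Schur complement of \<open>a k k\<close>, which is again
  elliptic, with the same constant \<open>c\<close>.
\<close>

lemma trace_product_nonneg:
  fixes a h :: "'i \<Rightarrow> 'i \<Rightarrow> real"
  assumes "finite S" and "0 < c"
    and "\<And>i j. i \<in> S \<Longrightarrow> j \<in> S \<Longrightarrow> a i j = a j i"
    and "\<And>\<eta>. c * (\<Sum>i\<in>S. (\<eta> i)\<^sup>2) \<le> (\<Sum>i\<in>S. \<Sum>j\<in>S. a i j * \<eta> i * \<eta> j)"
    and "\<And>\<eta>. 0 \<le> (\<Sum>i\<in>S. \<Sum>j\<in>S. h i j * \<eta> i * \<eta> j)"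
  shows "0 \<le> (\<Sum>i\<in>S. \<Sum>j\<in>S. a i j * h i j)"
  using assms
proof (induction S arbitrary: a rule: finite_induct)
  case empty
  then show ?case by simp
next
  case (insert k S)
  note sym = insert.prems(2) and ell = insert.prems(3) and psd = insert.prems(4)
  have split: "(\<Sum>i\<in>insert k S. \<Sum>j\<in>insert k S. F i j) =
      F k k + (\<Sum>j\<in>S. F k j) + (\<Sum>i\<in>S. F i k) + (\<Sum>i\<in>S. \<Sum>j\<in>S. F i j)" for F :: "'i \<Rightarrow> 'i \<Rightarrow> real"
    using insert.hyps by (simp add: sum.distrib algebra_simps)
  have akk: "0 < a k k"
  proof -
    define e where "e i = (if i = k then 1 else 0 :: real)" for i
    have ek: "e k = 1" and eS: "i \<in> S \<Longrightarrow> e i = 0" for i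
      using insert.hyps by (auto simp: e_def)
    have "c * (\<Sum>i\<in>insert k S. (e i)\<^sup>2) = c"
      using insert.hyps ek eS by simp
    moreover have "(\<Sum>i\<in>insert k S. \<Sum>j\<in>insert k S. a i j * e i * e j) = a k k"
      unfolding split using ek eS by simp
    ultimately show ?thesis
      using ell[of e] insert.prems(1) by linarith
  qed
  \<comment> \<open>The Schur complement of \<open>a k k\<close>; its row and column at \<open>k\<close> vanish.\<close>
  define a' where "a' i j = a i j - a k i * a k j / a k k" for i j
  have ell': "c * (\<Sum>i\<in>S. (\<eta> i)\<^sup>2) \<le> (\<Sum>i\<in>S. \<Sum>j\<in>S. a' i j * \<eta> i * \<eta> j)" for \<eta>
  proof -
    \<comment> \<open>The value of \<open>a'\<close> at \<open>\<eta>\<close> is that of \<open>a\<close> at the extension of \<open>\<eta>\<close> that minimises the form \<open>a\<close>.\<close>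
    define l where "l = (\<Sum>j\<in>S. a k j * \<eta> j)"
    define \<theta> where "\<theta> = \<eta>(k := - l / a k k)"
    have \<theta>k: "\<theta> k = - l / a k k" and \<theta>S: "i \<in> S \<Longrightarrow> \<theta> i = \<eta> i" for i
      using insert.hyps by (auto simp: \<theta>_def)
    have "(\<Sum>i\<in>S. (\<eta> i)\<^sup>2) = (\<Sum>i\<in>S. (\<theta> i)\<^sup>2)"
      using \<theta>S by simp
    also have "\<dots> \<le> (\<Sum>i\<in>insert k S. (\<theta> i)\<^sup>2)"
      using insert.hyps by simp
    finally have "c * (\<Sum>i\<in>S. (\<eta> i)\<^sup>2) \<le> c * (\<Sum>i\<in>insert k S. (\<theta> i)\<^sup>2)"
      using insert.prems(1) by simp
    also have "\<dots> \<le> (\<Sum>i\<in>insert k S. \<Sum>j\<in>insert k S. a i j * \<theta> i * \<theta> j)"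
      by (rule ell)
    also have "\<dots> = a k k * \<theta> k * \<theta> k + 2 * \<theta> k * l + (\<Sum>i\<in>S. \<Sum>j\<in>S. a i j * \<eta> i * \<eta> j)"
    proof -
      have "(\<Sum>j\<in>S. a k j * \<theta> k * \<theta> j) = \<theta> k * l"
        using \<theta>S by (simp add: l_def sum_distrib_left mult_ac)
      moreover have "(\<Sum>i\<in>S. a i k * \<theta> i * \<theta> k) = \<theta> k * l"
        using \<theta>S sym by (simp add: l_def sum_distrib_left mult_ac)
      ultimately show ?thesis
        unfolding split using \<theta>S by simp
    qed
    also have "a k k * \<theta> k * \<theta> k + 2 * \<theta> k * l = - l * l / a k k"
      using akk by (simp add: \<theta>k field_simps)
    also have "- l * l / a k k + (\<Sum>i\<in>S. \<Sum>j\<in>S. a i j * \<eta> i * \<eta> j) =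
        (\<Sum>i\<in>S. \<Sum>j\<in>S. a' i j * \<eta> i * \<eta> j)"
      by (simp add: a'_def l_def sum_product sum_divide_distrib sum_subtractf sum_negf
          algebra_simps)
    finally show ?thesis .
  qed
  have psd': "0 \<le> (\<Sum>i\<in>S. \<Sum>j\<in>S. h i j * \<eta> i * \<eta> j)" for \<eta>
  proof -
    have "(\<Sum>i\<in>insert k S. \<Sum>j\<in>insert k S. h i j * (\<eta>(k := 0)) i * (\<eta>(k := 0)) j) =
        (\<Sum>i\<in>S. \<Sum>j\<in>S. h i j * \<eta> i * \<eta> j)"
      unfolding split using insert.hyps by (auto intro!: sum.cong)
    then show ?thesis
      using psd[of "\<eta>(k := 0)"] by simp
  qed
  have "0 \<le> (\<Sum>i\<in>S. \<Sum>j\<in>S. a' i j * h i j)"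
    by (rule insert.IH) (use insert.prems(1) sym ell' psd' in \<open>auto simp: a'_def\<close>)
  moreover have "(\<Sum>i\<in>insert k S. \<Sum>j\<in>insert k S. a i j * h i j) =
      (\<Sum>i\<in>S. \<Sum>j\<in>S. a' i j * h i j) +
      (\<Sum>i\<in>insert k S. \<Sum>j\<in>insert k S. h i j * a k i * a k j) / a k k"
  proof -
    have "(\<Sum>i\<in>insert k S. \<Sum>j\<in>insert k S. a i j * h i j) -
        (\<Sum>i\<in>insert k S. \<Sum>j\<in>insert k S. h i j * a k i * a k j) / a k k =
        (\<Sum>i\<in>insert k S. \<Sum>j\<in>insert k S. a' i j * h i j)"
      by (simp only: a'_def sum_divide_distrib sum_subtractf[symmetric]) (simp add: algebra_simps)
    also have "\<dots> = (\<Sum>i\<in>S. \<Sum>j\<in>S. a' i j * h i j)"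
      unfolding split using akk sym by (simp add: a'_def)
    finally show ?thesis by simp
  qed
  ultimately show ?case
    using psd[of "a k"] akk by simp
qed

lemma sum_axis_component:
  fixes \<eta> :: "real^'n::finite"
  shows "(\<Sum>i\<in>UNIV. \<eta> $ i *\<^sub>R axis i 1) = \<eta>"
  by (simp add: vec_eq_iff axis_def if_distrib cong: if_cong)

text \<open>
  The induction adds the coordinate directions one at a time. The increment in the last direction
  is, by the mean value theorem, a partial derivative at an intermediate point that depends on \<open>s\<close>;
  continuity of that partial derivative in all variables jointly yields the limit.
\<close>

lemma directional_derivative_from_partials:
  fixes v :: "real^'n::finite \<Rightarrow> real" and D :: "'n \<Rightarrow> real^'n \<Rightarrow> real"
  assumes der: "\<And>i x. ((\<lambda>s. v (x + s *\<^sub>R axis i 1)) has_real_derivative D i x) (at 0)"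
    and cont: "\<And>i. continuous_on UNIV (D i)"
  shows "((\<lambda>s. v (x + s *\<^sub>R \<eta>)) has_real_derivative (\<Sum>i\<in>UNIV. \<eta> $ i * D i (x + t *\<^sub>R \<eta>))) (at t)"
proof -
  have line: "((\<lambda>s. v (y + s *\<^sub>R axis i 1)) has_real_derivative D i (y + s *\<^sub>R axis i 1)) (at s)" for i y s
    using der[of "y + s *\<^sub>R axis i 1" i] DERIV_shift[of "\<lambda>s. v (y + s *\<^sub>R axis i 1)" _ 0 s]
    by (simp add: algebra_simps)
  have mvt: "\<exists>\<theta>. \<bar>\<theta>\<bar> \<le> \<bar>r\<bar> \<and> v (y + r *\<^sub>R axis i 1) - v y = r * D i (y + \<theta> *\<^sub>R axis i 1)" for y r i
  proof (cases r "0::real" rule: linorder_cases)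
    case less
    obtain \<theta> where "r < \<theta>" "\<theta> < 0" "v (y + 0 *\<^sub>R axis i 1) - v (y + r *\<^sub>R axis i 1) = (0 - r) * D i (y + \<theta> *\<^sub>R axis i 1)"
      using MVT2[OF less, of "\<lambda>s. v (y + s *\<^sub>R axis i 1)" "\<lambda>s. D i (y + s *\<^sub>R axis i 1)"] line by auto
    then show ?thesis
      by (intro exI[of _ \<theta>]) (simp add: algebra_simps)
  next
    case greater
    obtain \<theta> where "0 < \<theta>" "\<theta> < r" "v (y + r *\<^sub>R axis i 1) - v (y + 0 *\<^sub>R axis i 1) = (r - 0) * D i (y + \<theta> *\<^sub>R axis i 1)"
      using MVT2[OF greater, of "\<lambda>s. v (y + s *\<^sub>R axis i 1)" "\<lambda>s. D i (y + s *\<^sub>R axis i 1)"] line by auto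
    then show ?thesis
      by (intro exI[of _ \<theta>]) (simp add: algebra_simps)
  qed (auto intro: exI[of _ 0])
  have step: "((\<lambda>s. v (z + s *\<^sub>R (\<Sum>i\<in>S. \<eta> $ i *\<^sub>R axis i 1))) has_real_derivative
      (\<Sum>i\<in>S. \<eta> $ i * D i z)) (at 0)" if "finite S" for S z
    using that
  proof (induction S rule: finite_induct)
    case empty
    then show ?case by simp
  next
    case (insert k S)
    define \<zeta> where "\<zeta> = (\<Sum>i\<in>S. \<eta> $ i *\<^sub>R axis i (1::real))"
    have "\<forall>s. \<exists>\<theta>. \<bar>\<theta>\<bar> \<le> \<bar>s * \<eta> $ k\<bar> \<and> v (z + s *\<^sub>R \<zeta> + (s * \<eta> $ k) *\<^sub>R axis k 1) - v (z + s *\<^sub>R \<zeta>) =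
        s * \<eta> $ k * D k (z + s *\<^sub>R \<zeta> + \<theta> *\<^sub>R axis k 1)"
      using mvt by blast
    then obtain \<theta> where \<theta>: "\<And>s. \<bar>\<theta> s\<bar> \<le> \<bar>s * \<eta> $ k\<bar>"
      and inc: "\<And>s. v (z + s *\<^sub>R \<zeta> + (s * \<eta> $ k) *\<^sub>R axis k 1) - v (z + s *\<^sub>R \<zeta>) =
        s * \<eta> $ k * D k (z + s *\<^sub>R \<zeta> + \<theta> s *\<^sub>R axis k 1)"
      by metis
    have "(\<theta> \<longlongrightarrow> 0) (at 0)"
    proof (rule Lim_null_comparison)
      show "\<forall>\<^sub>F s in at 0. norm (\<theta> s) \<le> \<bar>s * \<eta> $ k\<bar>"
        using \<theta> by simp
      show "((\<lambda>s. \<bar>s * \<eta> $ k\<bar>) \<longlongrightarrow> 0) (at 0)"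
        by (auto intro!: tendsto_eq_intros)
    qed
    then have arg: "((\<lambda>s. z + s *\<^sub>R \<zeta> + \<theta> s *\<^sub>R axis k 1) \<longlongrightarrow> z) (at 0)"
      by (auto intro!: tendsto_eq_intros)
    have "isCont (D k) z"
      using cont[of k] by (simp add: continuous_on_eq_continuous_at)
    from isCont_tendsto_compose[OF this arg]
    have lim: "((\<lambda>s. \<eta> $ k * D k (z + s *\<^sub>R \<zeta> + \<theta> s *\<^sub>R axis k 1)) \<longlongrightarrow> \<eta> $ k * D k z) (at 0)"
      by (intro tendsto_intros)
    have "((\<lambda>s. v (z + s *\<^sub>R \<zeta> + (s * \<eta> $ k) *\<^sub>R axis k 1) - v (z + s *\<^sub>R \<zeta>)) has_real_derivative \<eta> $ k * D k z) (at 0)"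
      unfolding DERIV_def
      by (rule Lim_transform_eventually[OF lim])
        (auto simp: inc eventually_at_filter)
    from DERIV_add[OF this insert.IH]
    show ?case
      using insert.hyps by (simp add: \<zeta>_def algebra_simps)
  qed
  have "((\<lambda>s. v (x + t *\<^sub>R \<eta> + s *\<^sub>R \<eta>)) has_real_derivative (\<Sum>i\<in>UNIV. \<eta> $ i * D i (x + t *\<^sub>R \<eta>))) (at 0)"
    using step[of UNIV "x + t *\<^sub>R \<eta>"] by (simp add: sum_axis_component)
  then show ?thesis
    using DERIV_shift[of "\<lambda>s. v (x + s *\<^sub>R \<eta>)" _ 0 t] by (simp add: algebra_simps)
qed

text \<open>
  Continuity of the second partials makes the second derivative of \<open>v\<close> along the line through \<open>z\<close> with
  direction \<open>\<eta>\<close> equal to the form \<open>H\<close> at \<open>\<eta>\<close>. The one-dimensional test along all lines thus shows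
  that \<open>H\<close> is positive semidefinite at \<open>z\<close>.
\<close>

lemma elliptic_sum_nonneg_at_minimum:
  fixes v :: "real^'n::finite \<Rightarrow> real" and D :: "'n \<Rightarrow> real^'n \<Rightarrow> real"
    and H :: "'n \<Rightarrow> 'n \<Rightarrow> real^'n \<Rightarrow> real" and A :: "'n \<Rightarrow> 'n \<Rightarrow> real"
  assumes D: "\<And>i x. ((\<lambda>s. v (x + s *\<^sub>R axis i 1)) has_real_derivative D i x) (at 0)"
      "\<And>i. continuous_on UNIV (D i)"
    and H: "\<And>i j x. ((\<lambda>s. D j (x + s *\<^sub>R axis i 1)) has_real_derivative H i j x) (at 0)"
      "\<And>i j. continuous_on UNIV (H i j)"
    and min: "\<And>x. v z \<le> v x"
    and A: "\<And>i j. A i j = A j i" "0 < c"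
      "\<And>\<eta>::real^'n. c * (norm \<eta>)\<^sup>2 \<le> (\<Sum>i\<in>UNIV. \<Sum>j\<in>UNIV. A i j * \<eta> $ i * \<eta> $ j)"
  shows "D i z = 0" and "0 \<le> (\<Sum>i\<in>UNIV. \<Sum>j\<in>UNIV. A i j * H i j z)"
proof -
  have g: "((\<lambda>s. v (z + s *\<^sub>R \<eta>)) has_real_derivative (\<Sum>j\<in>UNIV. \<eta> $ j * D j (z + s *\<^sub>R \<eta>))) (at s)" for \<eta> s
    by (rule directional_derivative_from_partials[OF D])
  have g': "((\<lambda>s. \<Sum>j\<in>UNIV. \<eta> $ j * D j (z + s *\<^sub>R \<eta>)) has_real_derivative
      (\<Sum>j\<in>UNIV. \<eta> $ j * (\<Sum>i\<in>UNIV. \<eta> $ i * H i j z))) (at 0)" for \<eta>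
  proof -
    have "((\<lambda>s. D j (z + s *\<^sub>R \<eta>)) has_real_derivative (\<Sum>i\<in>UNIV. \<eta> $ i * H i j z)) (at 0)" for j
      using directional_derivative_from_partials[of "D j" "\<lambda>i. H i j", OF H, of z \<eta> 0] by simp
    then show ?thesis
      by (intro DERIV_sum DERIV_cmult)
  qed
  note test = second_derivative_nonneg_at_minimum[OF g g']
  show "D i z = 0"
    using test(1)[of "axis i 1"] min by (simp add: axis_def if_distrib if_distribR cong: if_cong)
  have psd: "0 \<le> (\<Sum>i\<in>UNIV. \<Sum>j\<in>UNIV. H i j z * \<eta> i * \<eta> j)" for \<eta> :: "'n \<Rightarrow> real"
  proof -
    have "0 \<le> (\<Sum>j\<in>UNIV. (\<chi> i. \<eta> i) $ j * (\<Sum>i\<in>UNIV. (\<chi> i. \<eta> i) $ i * H i j z))"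
      using min by (intro test(2)) simp
    also have "\<dots> = (\<Sum>i\<in>UNIV. \<Sum>j\<in>UNIV. H i j z * \<eta> i * \<eta> j)"
      unfolding sum_distrib_left by (subst sum.swap) (simp add: mult_ac)
    finally show ?thesis .
  qed
  have ell: "c * (\<Sum>i\<in>UNIV. (\<eta> i)\<^sup>2) \<le> (\<Sum>i\<in>UNIV. \<Sum>j\<in>UNIV. A i j * \<eta> i * \<eta> j)" for \<eta> :: "'n \<Rightarrow> real"
    using A(3)[of "\<chi> i. \<eta> i"] by (simp add: norm_vec_def L2_set_def sum_nonneg)
  show "0 \<le> (\<Sum>i\<in>UNIV. \<Sum>j\<in>UNIV. A i j * H i j z)"
    by (rule trace_product_nonneg[of UNIV c A "\<lambda>i j. H i j z"]) (use A ell psd in auto)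
qed

text \<open>
  At an interior minimum the derivative is zero, but a minimum may sit at the final time \<open>T\<close>, where
  only earlier times are available for comparison. The inequality covers both cases.
\<close>

lemma left_derivative_nonpos_at_minimum:
  fixes g :: "real \<Rightarrow> real"
  assumes "(g has_real_derivative l) (at t within {0<..T})"
    and min: "\<And>s. s \<in> {0<..T} \<Longrightarrow> g t \<le> g s" and t: "0 < t" "t \<le> T"
  shows "l \<le> 0"
proof (rule ccontr)
  assume "\<not> l \<le> 0"
  then obtain d where d: "d > 0" "\<And>h. 0 < h \<Longrightarrow> t - h \<in> {0<..T} \<Longrightarrow> h < d \<Longrightarrow> g (t - h) < g t"
    using has_real_derivative_pos_inc_left[OF assms(1)] by auto
  define h where "h = min d t / 2"
  have "0 < h" "h < d" "t - h \<in> {0<..T}"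
    using d(1) t by (auto simp: h_def)
  with d(2) min show False
    by (meson not_less)
qed

section \<open>The nonlocal term\<close>

lemma lebesgue_reflect_translate:
  fixes x :: "'a::euclidean_space"
  shows "distr lebesgue lebesgue (\<lambda>y. x - y) = lebesgue"
    and "(\<lambda>y. x - y) \<in> lebesgue \<rightarrow>\<^sub>M lebesgue"
proof -
  have T: "(\<lambda>y. x + (\<Sum>j\<in>Basis. (- 1 * (y \<bullet> j)) *\<^sub>R j)) = (\<lambda>y. x - y)"
    by (simp add: sum_negf euclidean_representation)
  show "(\<lambda>y. x - y) \<in> lebesgue \<rightarrow>\<^sub>M lebesgue"
    using lebesgue_affine_measurable[of "\<lambda>_. - 1" x] unfolding T by simp
  show "distr lebesgue lebesgue (\<lambda>y. x - y) = lebesgue"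
    using lebesgue_affine_euclidean[of "\<lambda>_. - 1" x, symmetric] unfolding T by (simp add: density_1)
qed

lemma
  fixes \<phi> :: "'a::euclidean_space \<Rightarrow> real"
  assumes "integrable lebesgue \<phi>"
  shows integrable_reflect_translate: "integrable lebesgue (\<lambda>y. \<phi> (x - y))"
    and integral_reflect_translate: "(LINT y|lebesgue. \<phi> (x - y)) = (LINT y|lebesgue. \<phi> y)"
proof -
  note T = lebesgue_reflect_translate[of x]
  have meas: "\<phi> \<in> borel_measurable lebesgue"
    using assms by (rule borel_measurable_integrable)
  show "integrable lebesgue (\<lambda>y. \<phi> (x - y))"
    using integrable_distr_eq[OF T(2) meas] assms T(1) by simp
  show "(LINT y|lebesgue. \<phi> (x - y)) = (LINT y|lebesgue. \<phi> y)"
    using integral_distr[OF T(2) meas] T(1) by simp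
qed

lemma integrable_convolution_integrand:
  fixes \<phi> g :: "'a::euclidean_space \<Rightarrow> real"
  assumes "integrable lebesgue \<phi>" and "continuous_on UNIV g" and "bounded (range g)"
  shows "integrable lebesgue (\<lambda>y. \<phi> (x - y) * g y)"
proof -
  obtain B where B: "\<And>y. \<bar>g y\<bar> \<le> B"
    using assms(3) by (auto simp: bounded_iff)
  have meas: "g \<in> borel_measurable lebesgue"
    using borel_measurable_continuous_onI[OF assms(2)] by (simp add: measurable_completion)
  show ?thesis
  proof (rule Bochner_Integration.integrable_bound)
    show "integrable lebesgue (\<lambda>y. B * \<phi> (x - y))"
      using integrable_reflect_translate[OF assms(1)] by simp
    show "(\<lambda>y. \<phi> (x - y) * g y) \<in> borel_measurable lebesgue"
      using borel_measurable_integrable[OF integrable_reflect_translate[OF assms(1)]] meas by simp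
    have "norm (\<phi> (x - y) * g y) \<le> norm (B * \<phi> (x - y))" for y
      using mult_left_mono[OF order_trans[OF B abs_ge_self, of y], of "\<bar>\<phi> (x - y)\<bar>"]
      by (simp add: abs_mult mult_ac)
    then show "AE y in lebesgue. norm (\<phi> (x - y) * g y) \<le> norm (B * \<phi> (x - y))"
      by simp
  qed
qed

lemma convolution_lower_bound:
  fixes \<phi> g :: "'a::euclidean_space \<Rightarrow> real"
  assumes "integrable lebesgue \<phi>" and "\<And>y. 0 \<le> \<phi> y"
    and "continuous_on UNIV g" and "bounded (range g)" and "\<And>y. - c \<le> g y"
  shows "- c * (LINT y|lebesgue. \<phi> y) \<le> (LINT y|lebesgue. \<phi> (x - y) * g y)"
proof -
  have "- c * (LINT y|lebesgue. \<phi> y) = (LINT y|lebesgue. \<phi> (x - y) * (- c))"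
    by (simp add: integral_reflect_translate[OF assms(1)])
  also have "\<dots> \<le> (LINT y|lebesgue. \<phi> (x - y) * g y)"
    using assms integrable_reflect_translate[OF assms(1)] integrable_convolution_integrand[OF assms(1,3,4)]
    by (intro integral_mono mult_left_mono) auto
  finally show ?thesis .
qed

lemma time_slice:
  assumes "continuous_on (closed_cyl T) u" and "u \<in> L_infty (closed_cyl T)" and "t \<in> {0..T}"
  shows "continuous_on UNIV (\<lambda>y. u (y, t))" and "bounded (range (\<lambda>y. u (y, t)))"
proof -
  show "continuous_on UNIV (\<lambda>y. u (y, t))"
    by (rule continuous_on_compose2[OF assms(1)])
      (use assms(3) in \<open>auto simp: closed_cyl_def intro!: continuous_intros\<close>)
  show "bounded (range (\<lambda>y. u (y, t)))"
    by (rule bounded_subset[of "u ` closed_cyl T"])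
      (use assms(2,3) in \<open>auto simp: closed_cyl_def L_infty_def\<close>)
qed

lemma J_op_diff:
  assumes "integrable lebesgue \<phi>" and "(x, t) \<in> closed_cyl T"
    and "continuous_on (closed_cyl T) u" "u \<in> L_infty (closed_cyl T)"
    and "continuous_on (closed_cyl T) v" "v \<in> L_infty (closed_cyl T)"
  shows "J_op \<phi> (\<lambda>p. u p - v p) (x, t) = J_op \<phi> u (x, t) - J_op \<phi> v (x, t)"
proof -
  have t: "t \<in> {0..T}"
    using assms(2) by (simp add: closed_cyl_def)
  show ?thesis
    using integrable_convolution_integrand[OF assms(1) time_slice[OF assms(3,4) t]]
      integrable_convolution_integrand[OF assms(1) time_slice[OF assms(5,6) t]]
    by (simp add: J_op_def right_diff_distrib Bochner_Integration.integral_diff)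
qed

lemma J_op_lower_bound:
  assumes "integrable lebesgue \<phi>" "\<And>y. 0 \<le> \<phi> y" and "(x, t) \<in> closed_cyl T"
    and "continuous_on (closed_cyl T) u" "u \<in> L_infty (closed_cyl T)"
    and "\<And>y. - c \<le> u (y, t)"
  shows "- c * (LINT y|lebesgue. \<phi> y) \<le> J_op \<phi> u (x, t)"
proof -
  have t: "t \<in> {0..T}"
    using assms(3) by (simp add: closed_cyl_def)
  show ?thesis
    using convolution_lower_bound[OF assms(1,2) time_slice[OF assms(4,5) t] assms(6)]
    by (simp add: J_op_def)
qed

lemma J_op_bounded:
  assumes "integrable lebesgue \<phi>" "\<And>y. 0 \<le> \<phi> y"
    and "continuous_on (closed_cyl T) u" "u \<in> L_infty (closed_cyl T)"
  shows "bounded (J_op \<phi> u ` closed_cyl T)"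
proof -
  obtain B where B: "\<And>p. p \<in> closed_cyl T \<Longrightarrow> \<bar>u p\<bar> \<le> B"
    using assms(4) by (auto simp: bounded_iff L_infty_def)
  have neg: "continuous_on (closed_cyl T) (\<lambda>p. - u p)" "(\<lambda>p. - u p) \<in> L_infty (closed_cyl T)"
    using assms(3,4) by (auto simp: L_infty_def bounded_iff intro!: continuous_intros)
  have "\<bar>J_op \<phi> u (x, t)\<bar> \<le> B * (LINT y|lebesgue. \<phi> y)" if xt: "(x, t) \<in> closed_cyl T" for x t
  proof -
    have "\<bar>u (y, t)\<bar> \<le> B" for y
      using B[of "(y, t)"] xt by (simp add: closed_cyl_def)
    then have "- B \<le> u (y, t)" "- B \<le> - u (y, t)" for y
      by (simp_all add: abs_le_iff minus_le_iff)
    from J_op_lower_bound[OF assms(1,2) xt assms(3,4) this(1)]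
      J_op_lower_bound[OF assms(1,2) xt neg this(2)]
    show ?thesis
      by (simp add: J_op_def abs_le_iff)
  qed
  then show ?thesis
    unfolding bounded_iff by (force intro: exI[of _ "B * (LINT y|lebesgue. \<phi> y)"])
qed

lemma mem_range_hull:
  fixes g h :: "'b \<Rightarrow> real"
  assumes g: "bounded (g ` X)" and h: "bounded (h ` X)" and p: "p \<in> X" and r: "r \<in> {g p, h p}"
  shows "r \<in> {INF q\<in>X. min (g q) (h q) .. SUP q\<in>X. max (g q) (h q)}"
proof -
  obtain B C where BC: "\<And>q. q \<in> X \<Longrightarrow> \<bar>g q\<bar> \<le> B" "\<And>q. q \<in> X \<Longrightarrow> \<bar>h q\<bar> \<le> C"
    using g h by (auto simp: bounded_iff)
  have "bdd_below ((\<lambda>q. min (g q) (h q)) ` X)"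
    by (rule bdd_belowI2[of _ "min (- B) (- C)"]) (use BC in \<open>force simp: abs_le_iff\<close>)
  moreover have "bdd_above ((\<lambda>q. max (g q) (h q)) ` X)"
    by (rule bdd_aboveI2[of _ _ "max B C"]) (use BC in \<open>force simp: abs_le_iff\<close>)
  ultimately show ?thesis
    using cINF_lower[OF _ p, of "\<lambda>q. min (g q) (h q)"] cSUP_upper[OF p, of "\<lambda>q. max (g q) (h q)"] r
    by fastforce
qed

text \<open>
  The conditions on \<open>f\<close> hold only on the rectangle of values. It contains all four combinations of
  the arguments, in particular the mixed pair \<open>(v, J u)\<close> through which two values of \<open>f\<close> are
  compared one argument at a time.
\<close>

lemma mem_K_rect:
  assumes "integrable lebesgue \<phi>" "\<And>y. 0 \<le> \<phi> y"
    and "continuous_on (closed_cyl T) u" "u \<in> L_infty (closed_cyl T)"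
    and "continuous_on (closed_cyl T) v" "v \<in> L_infty (closed_cyl T)"
    and "p \<in> closed_cyl T" and "r \<in> {u p, v p}" and "s \<in> {J_op \<phi> u p, J_op \<phi> v p}"
  shows "(r, s) \<in> K_rect T \<phi> u v"
proof -
  show ?thesis
    using mem_range_hull[OF _ _ assms(7), of u v] mem_range_hull[OF _ _ assms(7), of "J_op \<phi> u" "J_op \<phi> v"]
      assms(8,9) assms(4,6)
      J_op_bounded[OF assms(1-4)] J_op_bounded[OF assms(1,2,5,6)]
    by (simp add: K_rect_def L_infty_def)
qed

text \<open>
  This is where the nonlocality is tamed: at a point where \<open>u \<le> v\<close>, the difference of the reaction terms is
  controlled by a bound for the negative part of \<open>u - v\<close> on the time slice alone. Change first the
  local argument, at the price of its Lipschitz constant times \<open>c\<close>, then the nonlocal one. The second change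
  can only be harmful if \<open>J u < J v\<close>, and then \<open>J v - J u\<close> is at most \<open>c\<close> times the integral of
  \<open>\<phi>\<close>, because \<open>\<phi> \<ge> 0\<close>.
\<close>

lemma reaction_difference_lower_bound:
  assumes phi: "integrable lebesgue \<phi>" "\<And>y. 0 \<le> \<phi> y"
    and u: "continuous_on (closed_cyl T) u" "u \<in> L_infty (closed_cyl T)"
    and v: "continuous_on (closed_cyl T) v" "v \<in> L_infty (closed_cyl T)"
    and mono: "nondecreasing_in_v (cyl T) (K_rect T \<phi> u v) f"
    and lip_u: "lipschitz_in_u (cyl T) (K_rect T \<phi> u v) f"
    and lip_v: "lipschitz_in_v (cyl T) (K_rect T \<phi> u v) f"
  obtains C where "0 \<le> C"
    and "\<And>x t c. (x, t) \<in> cyl T \<Longrightarrow> u (x, t) \<le> v (x, t) \<Longrightarrow> (\<And>y. - c \<le> u (y, t) - v (y, t)) \<Longrightarrow>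
      - C * c \<le> f x t (u (x, t)) (J_op \<phi> u (x, t)) - f x t (v (x, t)) (J_op \<phi> v (x, t))"
proof -
  obtain k1 where k1: "0 \<le> k1" "\<And>x t r1 r2 s. (x, t) \<in> cyl T \<Longrightarrow> (r1, s) \<in> K_rect T \<phi> u v \<Longrightarrow>
      (r2, s) \<in> K_rect T \<phi> u v \<Longrightarrow> \<bar>f x t r1 s - f x t r2 s\<bar> \<le> k1 * \<bar>r1 - r2\<bar>"
    using lip_u unfolding lipschitz_in_u_def by blast
  obtain k2 where k2: "0 \<le> k2" "\<And>x t r s1 s2. (x, t) \<in> cyl T \<Longrightarrow> (r, s1) \<in> K_rect T \<phi> u v \<Longrightarrow>
      (r, s2) \<in> K_rect T \<phi> u v \<Longrightarrow> \<bar>f x t r s1 - f x t r s2\<bar> \<le> k2 * \<bar>s1 - s2\<bar>"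
    using lip_v unfolding lipschitz_in_v_def by blast
  define \<Phi> where "\<Phi> = (LINT y|lebesgue. \<phi> y)"
  have \<Phi>: "0 \<le> \<Phi>"
    unfolding \<Phi>_def using phi(2) by simp
  have "- (k1 + k2 * \<Phi>) * c \<le>
      f x t (u (x, t)) (J_op \<phi> u (x, t)) - f x t (v (x, t)) (J_op \<phi> v (x, t))"
    if xt: "(x, t) \<in> cyl T" and le: "u (x, t) \<le> v (x, t)" and c: "\<And>y. - c \<le> u (y, t) - v (y, t)"
    for x t c
  proof -
    have xt': "(x, t) \<in> closed_cyl T"
      using xt by (auto simp: cyl_def closed_cyl_def)
    note K = mem_K_rect[OF phi u v xt']
    have "0 \<le> c"
      using c[of x] le by linarith
    have "\<bar>f x t (u (x, t)) (J_op \<phi> u (x, t)) - f x t (v (x, t)) (J_op \<phi> u (x, t))\<bar>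
        \<le> k1 * \<bar>u (x, t) - v (x, t)\<bar>"
      using xt K by (intro k1(2)) auto
    also have "\<dots> \<le> k1 * c"
      using c[of x] le k1(1) by (intro mult_left_mono) auto
    finally have local: "- (k1 * c) \<le> f x t (u (x, t)) (J_op \<phi> u (x, t)) - f x t (v (x, t)) (J_op \<phi> u (x, t))"
      by linarith
    have "- (k2 * (\<Phi> * c)) \<le> f x t (v (x, t)) (J_op \<phi> u (x, t)) - f x t (v (x, t)) (J_op \<phi> v (x, t))"
    proof (cases "J_op \<phi> v (x, t) \<le> J_op \<phi> u (x, t)")
      case True
      then have "f x t (v (x, t)) (J_op \<phi> v (x, t)) \<le> f x t (v (x, t)) (J_op \<phi> u (x, t))"
        using mono xt K[of "v (x, t)"] unfolding nondecreasing_in_v_def by blast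
      then show ?thesis
        using k2(1) \<Phi> \<open>0 \<le> c\<close> by (smt (verit) mult_nonneg_nonneg)
    next
      case False
      have "continuous_on (closed_cyl T) (\<lambda>p. u p - v p)"
        using u(1) v(1) by (intro continuous_intros)
      moreover have "(\<lambda>p. u p - v p) \<in> L_infty (closed_cyl T)"
        using u(2) v(2) by (auto simp: L_infty_def intro: bounded_minus_comp)
      ultimately have "- c * \<Phi> \<le> J_op \<phi> (\<lambda>p. u p - v p) (x, t)"
        unfolding \<Phi>_def using c by (intro J_op_lower_bound[OF phi xt'])
      then have "\<bar>J_op \<phi> u (x, t) - J_op \<phi> v (x, t)\<bar> \<le> \<Phi> * c"
        using False J_op_diff[OF phi(1) xt' u v] by (simp add: mult.commute)
      then have "k2 * \<bar>J_op \<phi> u (x, t) - J_op \<phi> v (x, t)\<bar> \<le> k2 * (\<Phi> * c)"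
        using k2(1) by (rule mult_left_mono)
      moreover have "\<bar>f x t (v (x, t)) (J_op \<phi> u (x, t)) - f x t (v (x, t)) (J_op \<phi> v (x, t))\<bar>
          \<le> k2 * \<bar>J_op \<phi> u (x, t) - J_op \<phi> v (x, t)\<bar>"
        using xt K by (intro k2(2)) auto
      ultimately show ?thesis
        by linarith
    qed
    with local show ?thesis
      by (simp add: algebra_simps)
  qed
  then show ?thesis
    using that[of "k1 + k2 * \<Phi>"] k1(1) k2(1) \<Phi> by simp
qed

section \<open>The maximum principle with a nonlocal perturbation\<close>

text \<open>
  Since \<open>W\<close> is bounded below, the penalised function is nonnegative outside a compact piece of the
  cylinder, so a negative value at \<open>p\<close> forces the infimum to be attained on that piece.
\<close>

lemma penalized_minimum_exists:
  fixes W :: "(real^'n::finite) \<times> real \<Rightarrow> real"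
  assumes W: "continuous_on (closed_cyl T) W" "\<And>p. p \<in> closed_cyl T \<Longrightarrow> - m \<le> W p"
    and "0 < \<epsilon>" and p: "p \<in> closed_cyl T" "W p + \<epsilon> * (1 + (norm (fst p))\<^sup>2) < 0"
  obtains q where "q \<in> closed_cyl T"
    and "\<And>p. p \<in> closed_cyl T \<Longrightarrow>
      W q + \<epsilon> * (1 + (norm (fst q))\<^sup>2) \<le> W p + \<epsilon> * (1 + (norm (fst p))\<^sup>2)"
proof -
  define V where "V p = W p + \<epsilon> * (1 + (norm (fst p))\<^sup>2)" for p
  define R where "R = max 0 (m / \<epsilon>) + 1"
  define B where "B = (cball 0 R \<times> {0..T} :: ((real^'n) \<times> real) set)"
  have BT: "B \<subseteq> closed_cyl T"
    by (auto simp: B_def closed_cyl_def)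
  have far: "0 \<le> V x" if "x \<in> closed_cyl T" "x \<notin> B" for x
  proof -
    have R: "R < norm (fst x)" "1 \<le> R"
      using that by (auto simp: B_def closed_cyl_def R_def)
    have "m / \<epsilon> \<le> R"
      by (simp add: R_def)
    also have "R \<le> (norm (fst x))\<^sup>2"
      using R by (smt (verit) power2_eq_square mult_le_cancel_right1)
    finally have "m \<le> \<epsilon> * (norm (fst x))\<^sup>2"
      using assms(3) by (simp add: field_simps)
    then show ?thesis
      using W(2)[OF that(1)] assms(3) by (simp add: V_def algebra_simps)
  qed
  have "p \<in> B"
    using far[OF p(1)] p(2) by (force simp: V_def)
  moreover have "compact B"
    unfolding B_def by (intro compact_Times) auto
  moreover have "continuous_on B V"
    unfolding V_def by (intro continuous_intros continuous_on_subset[OF W(1) BT])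
  ultimately obtain q where q: "q \<in> B" "\<And>x. x \<in> B \<Longrightarrow> V q \<le> V x"
    using continuous_attains_inf[of B V] by blast
  have "V q < 0"
    using q(2)[OF \<open>p \<in> B\<close>] p(2) by (simp add: V_def)
  then have "V q \<le> V x" if "x \<in> closed_cyl T" for x
    using far[OF that] q(2)[of x] by (cases "x \<in> B") auto
  with q(1) BT show ?thesis
    using that[of q] unfolding V_def by blast
qed

text \<open>
  The left-hand side is the elliptic operator applied to the penalty \<open>1 + |x|\<^sup>2\<close>, whose gradient is
  \<open>2 * x\<close> and whose Hessian is twice the identity. It grows no faster than the penalty itself, so
  an exponential factor in time can absorb it.
\<close>

lemma penalty_bound:
  fixes x :: "real^'n::finite" and A :: "'n \<Rightarrow> 'n \<Rightarrow> real" and b :: "'n \<Rightarrow> real"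
  assumes "\<And>i. \<bar>A i i\<bar> \<le> B" and "\<And>i. \<bar>b i\<bar> \<le> B"
  shows "(\<Sum>i\<in>UNIV. \<Sum>j\<in>UNIV. A i j * (if i = j then 2 else 0)) + (\<Sum>i\<in>UNIV. b i * (2 * x $ i))
    \<le> 3 * real CARD('n) * B * (1 + (norm x)\<^sup>2)"
proof -
  have "0 \<le> B"
    using assms(2) abs_ge_zero order_trans by blast
  have "(\<Sum>i\<in>UNIV. \<Sum>j\<in>UNIV. A i j * (if i = j then 2 else 0)) + (\<Sum>i\<in>UNIV. b i * (2 * x $ i))
      = (\<Sum>i\<in>UNIV. 2 * A i i + b i * (2 * x $ i))"
    by (simp add: if_distrib sum.distrib mult.commute cong: if_cong)
  also have "\<dots> \<le> (\<Sum>i\<in>(UNIV::'n set). 3 * B * (1 + (norm x)\<^sup>2))"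
  proof (rule sum_mono)
    fix i
    have "A i i \<le> B"
      using assms(1) by (rule abs_le_D1)
    then have "2 * A i i \<le> 2 * B * (1 + (norm x)\<^sup>2)"
      using mult_left_mono[of 1 "1 + (norm x)\<^sup>2" "2 * B"] \<open>0 \<le> B\<close> by simp
    moreover have "b i * (2 * x $ i) \<le> B * (1 + (norm x)\<^sup>2)"
    proof -
      have "(x $ i)\<^sup>2 \<le> (norm x)\<^sup>2"
        using component_le_norm_cart[of x i] by (simp add: abs_le_square_iff[symmetric])
      moreover have "\<bar>2 * x $ i\<bar> \<le> 1 + (x $ i)\<^sup>2"
        using zero_le_power2[of "\<bar>x $ i\<bar> - 1"] by (simp add: power2_diff abs_mult)
      ultimately have "\<bar>2 * x $ i\<bar> \<le> 1 + (norm x)\<^sup>2"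
        by linarith
      then have "\<bar>b i * (2 * x $ i)\<bar> \<le> B * (1 + (norm x)\<^sup>2)"
        unfolding abs_mult[of "b i"] using assms(2) \<open>0 \<le> B\<close> by (intro mult_mono) auto
      then show ?thesis
        by linarith
    qed
    ultimately show "2 * A i i + b i * (2 * x $ i) \<le> 3 * B * (1 + (norm x)\<^sup>2)"
      by (simp add: algebra_simps)
  qed
  finally show ?thesis
    by (simp add: mult_ac)
qed

text \<open>
  The premise \<open>supersolution\<close> is the differential inequality that remains of \<open>P[u] \<le> P[v]\<close> for
  \<open>w = u - v\<close>: the reaction terms have been replaced by their worst case \<open>- C * d\<close>, where \<open>- d\<close> is any
  lower bound for \<open>w\<close> on the time slice. The derivatives of \<open>w\<close> are passed as separate functions
  \<open>D\<close>, \<open>H\<close> and \<open>wt\<close>, so that differences of given partial derivatives can be inserted directly.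
\<close>

lemma nonlocal_maximum_principle:
  fixes w wt :: "(real^'n::finite) \<times> real \<Rightarrow> real"
    and D :: "'n \<Rightarrow> (real^'n) \<times> real \<Rightarrow> real" and H :: "'n \<Rightarrow> 'n \<Rightarrow> (real^'n) \<times> real \<Rightarrow> real"
    and a :: "'n \<Rightarrow> 'n \<Rightarrow> (real^'n) \<times> real \<Rightarrow> real" and b :: "'n \<Rightarrow> (real^'n) \<times> real \<Rightarrow> real"
  assumes a_sym: "\<And>i j p. p \<in> cyl T \<Longrightarrow> a i j p = a j i p"
    and elliptic: "0 < c" "\<And>p (\<eta>::real^'n). p \<in> cyl T \<Longrightarrow>
        c * (norm \<eta>)\<^sup>2 \<le> (\<Sum>i\<in>UNIV. \<Sum>j\<in>UNIV. a i j p * \<eta> $ i * \<eta> $ j)"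
    and coeff_bound: "\<And>i p. p \<in> cyl T \<Longrightarrow> \<bar>a i i p\<bar> \<le> B" "\<And>i p. p \<in> cyl T \<Longrightarrow> \<bar>b i p\<bar> \<le> B"
    and w: "continuous_on (closed_cyl T) w" "w \<in> L_infty (closed_cyl T)"
    and D: "\<And>i x t. (x, t) \<in> cyl T \<Longrightarrow>
        ((\<lambda>s. w (x + s *\<^sub>R axis i 1, t)) has_real_derivative D i (x, t)) (at 0)"
      "\<And>i. continuous_on (cyl T) (D i)"
    and H: "\<And>i j x t. (x, t) \<in> cyl T \<Longrightarrow>
        ((\<lambda>s. D j (x + s *\<^sub>R axis i 1, t)) has_real_derivative H i j (x, t)) (at 0)"
      "\<And>i j. continuous_on (cyl T) (H i j)"
    and wt: "\<And>x t. (x, t) \<in> cyl T \<Longrightarrow>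
        ((\<lambda>s. w (x, s)) has_real_derivative wt (x, t)) (at t within {0<..T})"
    and C: "0 \<le> C"
    and supersolution: "\<And>x t d. (x, t) \<in> cyl T \<Longrightarrow> w (x, t) \<le> 0 \<Longrightarrow> (\<And>y. - d \<le> w (y, t)) \<Longrightarrow>
        (\<Sum>i\<in>UNIV. \<Sum>j\<in>UNIV. a i j (x, t) * H i j (x, t)) + (\<Sum>i\<in>UNIV. b i (x, t) * D i (x, t))
          - wt (x, t) \<le> C * d"
    and initial: "\<And>x. 0 \<le> w (x, 0)"
    and p: "p \<in> closed_cyl T"
  shows "0 \<le> w p"
proof (rule ccontr)
  assume "\<not> 0 \<le> w p"
  define \<psi> where "\<psi> x = 1 + (norm x)\<^sup>2" for x :: "real^'n"
  have \<psi>: "1 \<le> \<psi> x" for x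
    by (simp add: \<psi>_def)
  define K where "K = 3 * real CARD('n) * \<bar>B\<bar>"
  \<comment> \<open>\<open>K\<close> absorbs the penalty and \<open>2 * C\<close> the nonlocal term, the factor 2 since the minimum lies only
      below \<open>- m / 2\<close>; the summand 1 makes the final inequality strict.\<close>
  define \<mu> where "\<mu> = K + 2 * C + 1"
  have "0 \<le> K"
    by (simp add: K_def)
  define W where "W q = exp (- \<mu> * snd q) * w q" for q
  obtain M where M: "\<And>q. q \<in> closed_cyl T \<Longrightarrow> \<bar>w q\<bar> \<le> M"
    using w(2) by (auto simp: L_infty_def bounded_iff)
  have "\<bar>W q\<bar> \<le> M" if "q \<in> closed_cyl T" for q
  proof -
    have "exp (- \<mu> * snd q) \<le> 1"
      using that \<open>0 \<le> K\<close> C by (auto simp: closed_cyl_def \<mu>_def intro: mult_nonpos_nonneg)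
    then have "\<bar>W q\<bar> \<le> 1 * \<bar>w q\<bar>"
      unfolding W_def abs_mult by (intro mult_right_mono) auto
    then show ?thesis
      using M[OF that] by simp
  qed
  then have "bdd_above ((\<lambda>q. - W q) ` closed_cyl T)"
    by (intro bdd_aboveI2[of _ _ M]) (force simp: abs_le_iff)
  define m where "m = (SUP q\<in>closed_cyl T. - W q)"
  have m: "- m \<le> W q" if "q \<in> closed_cyl T" for q
    using cSUP_upper[OF that \<open>bdd_above _\<close>] by (simp add: m_def)
  have "W p < 0"
    using \<open>\<not> 0 \<le> w p\<close> by (simp add: W_def mult_less_0_iff)
  then have "0 < m"
    using m[OF p] by linarith
  have "3 * m / 4 < (SUP q\<in>closed_cyl T. - W q)"
    using \<open>0 < m\<close> by (simp add: m_def[symmetric])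
  then have "\<exists>q\<in>closed_cyl T. 3 * m / 4 < - W q"
    using p \<open>bdd_above _\<close> by (subst (asm) less_cSUP_iff) auto
  then obtain p' where p': "p' \<in> closed_cyl T" "W p' < - 3 * m / 4"
    by force
  \<comment> \<open>With this \<open>\<epsilon>\<close> the penalty costs only \<open>m / 4\<close> at the near-minimiser \<open>p'\<close>, leaving a value below \<open>- m / 2\<close>.\<close>
  define \<epsilon> where "\<epsilon> = m / (4 * \<psi> (fst p'))"
  have \<epsilon>: "0 < \<epsilon>" "\<epsilon> * \<psi> (fst p') = m / 4"
    using \<open>0 < m\<close> \<psi>[of "fst p'"] by (auto simp: \<epsilon>_def)
  have W_cont: "continuous_on (closed_cyl T) W"
    unfolding W_def by (intro continuous_intros w(1))
  have "W p' + \<epsilon> * (1 + (norm (fst p'))\<^sup>2) < 0"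
    using p'(2) \<epsilon>(2) \<open>0 < m\<close> by (simp add: \<psi>_def)
  from penalized_minimum_exists[OF W_cont m \<epsilon>(1) p'(1) this]
  obtain q where q: "q \<in> closed_cyl T"
    and "\<And>r. r \<in> closed_cyl T \<Longrightarrow>
      W q + \<epsilon> * (1 + (norm (fst q))\<^sup>2) \<le> W r + \<epsilon> * (1 + (norm (fst r))\<^sup>2)"
    by blast
  then have q_min: "W q + \<epsilon> * \<psi> (fst q) \<le> W r + \<epsilon> * \<psi> (fst r)" if "r \<in> closed_cyl T" for r
    using that by (simp add: \<psi>_def)
  obtain z t where zt: "q = (z, t)"
    by (cases q)
  have neg: "W q + \<epsilon> * \<psi> z < - m / 2"
    using q_min[OF p'(1)] p'(2) \<epsilon>(2) by (simp add: zt)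
  moreover have "0 < \<epsilon> * \<psi> z"
    using \<epsilon>(1) \<psi>[of z] by simp
  ultimately have "W q < 0"
    using \<open>0 < m\<close> by linarith
  have "t \<noteq> 0"
    using initial[of z] \<open>W q < 0\<close> by (auto simp: W_def zt)
  with q have t: "0 < t" "t \<le> T" and qT: "(z, t) \<in> cyl T"
    by (auto simp: zt closed_cyl_def cyl_def)
  have slice: "(x, t) \<in> cyl T" "(x, t) \<in> closed_cyl T" for x :: "real^'n"
    using t by (auto simp: cyl_def closed_cyl_def)
  define E where "E = exp (- \<mu> * t)"
  have "0 < E"
    by (simp add: E_def)
  have W_slice: "W (y, t) = E * w (y, t)" for y
    by (simp add: W_def E_def)

  have time: "E * wt (z, t) \<le> \<mu> * W q"
  proof -
    have "((\<lambda>s. W (z, s) + \<epsilon> * \<psi> z) has_real_derivative - \<mu> * W q + E * wt (z, t)) (at t within {0<..T})"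
      unfolding W_def using wt[OF qT]
      by (auto intro!: derivative_eq_intros simp: zt E_def)
    moreover have "W (z, t) + \<epsilon> * \<psi> z \<le> W (z, s) + \<epsilon> * \<psi> z" if "s \<in> {0<..T}" for s
      using q_min[of "(z, s)"] that by (simp add: closed_cyl_def zt)
    ultimately have "- \<mu> * W q + E * wt (z, t) \<le> 0"
      using t by (rule left_derivative_nonpos_at_minimum)
    then show ?thesis
      by simp
  qed

  have cont_slice: "continuous_on UNIV (\<lambda>x. g (x, t))" if "continuous_on (cyl T) g" for g :: "(real^'n) \<times> real \<Rightarrow> real"
    by (rule continuous_on_compose2[OF that]) (auto intro!: continuous_intros slice)
  define v where "v x = E * w (x, t) + \<epsilon> * \<psi> x" for x
  define Dv where "Dv i x = E * D i (x, t) + \<epsilon> * (2 * x $ i)" for i x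
  define Hv where "Hv i j x = E * H i j (x, t) + \<epsilon> * (if i = j then 2 else 0)" for i j x
  have \<psi>_line: "\<psi> (x + s *\<^sub>R axis i 1) = \<psi> x + 2 * s * x $ i + s\<^sup>2" for x s i
    unfolding \<psi>_def power2_norm_eq_inner
    by (simp add: inner_add_left inner_add_right inner_axis inner_axis' power2_eq_square algebra_simps)
  have Dv: "((\<lambda>s. v (x + s *\<^sub>R axis i 1)) has_real_derivative Dv i x) (at 0)" for i x
    unfolding v_def Dv_def \<psi>_line
    by (auto intro!: derivative_eq_intros D(1) slice)
  have Hv: "((\<lambda>s. Dv j (x + s *\<^sub>R axis i 1)) has_real_derivative Hv i j x) (at 0)" for i j x
  proof -
    have "(x + s *\<^sub>R axis i 1) $ j = x $ j + s * (if i = j then 1 else 0)" for s :: real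
      by (simp add: axis_def)
    then have "Dv j (x + s *\<^sub>R axis i 1) =
        E * D j (x + s *\<^sub>R axis i 1, t) + \<epsilon> * (2 * (x $ j + s * (if i = j then 1 else 0)))" for s
      unfolding Dv_def by simp
    then show ?thesis
      unfolding Hv_def by (auto intro!: derivative_eq_intros H(1) slice)
  qed
  have cont: "continuous_on UNIV (Dv i)" "continuous_on UNIV (Hv i j)" for i j
    unfolding Dv_def Hv_def by (intro continuous_intros cont_slice D(2) H(2))+
  have v_min: "v z \<le> v x" for x
    using q_min[OF slice(2)[of x]] by (simp add: v_def W_def E_def zt)
  note crit = elliptic_sum_nonneg_at_minimum[of v Dv Hv z "\<lambda>i j. a i j (z, t)" c,
      OF Dv cont(1) Hv cont(2) v_min a_sym[OF qT] elliptic(1) elliptic(2)[OF qT]]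

  let ?L2 = "\<Sum>i\<in>UNIV. \<Sum>j\<in>UNIV. a i j (z, t) * H i j (z, t)"
  let ?L1 = "\<Sum>i\<in>UNIV. b i (z, t) * D i (z, t)"
  let ?P2 = "\<Sum>i\<in>UNIV. \<Sum>j\<in>UNIV. a i j (z, t) * (if i = j then 2 else 0)"
  let ?P1 = "\<Sum>i\<in>UNIV. b i (z, t) * (2 * z $ i)"
  have second: "0 \<le> E * ?L2 + \<epsilon> * ?P2"
    using crit(2) by (simp add: Hv_def sum.distrib sum_distrib_left distrib_left mult_ac)
  have first: "0 = E * ?L1 + \<epsilon> * ?P1"
  proof -
    have "0 = (\<Sum>i\<in>UNIV. b i (z, t) * Dv i z)"
      using crit(1) by simp
    also have "\<dots> = E * ?L1 + \<epsilon> * ?P1"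
      by (simp add: Dv_def sum.distrib sum_distrib_left distrib_left mult_ac)
    finally show ?thesis .
  qed
  have "?P2 + ?P1 \<le> K * \<psi> z"
    unfolding K_def \<psi>_def
    by (rule penalty_bound[of "\<lambda>i j. a i j (z, t)" _ "\<lambda>i. b i (z, t)"])
      (use order_trans[OF coeff_bound(1)[OF qT] abs_ge_self]
        order_trans[OF coeff_bound(2)[OF qT] abs_ge_self] in auto)
  then have penalty: "\<epsilon> * (?P2 + ?P1) \<le> \<epsilon> * (K * \<psi> z)"
    using \<epsilon>(1) by simp

  \<comment> \<open>On the slice at time \<open>t\<close>, the definition of \<open>m\<close> bounds \<open>w\<close> from below by \<open>- m / E\<close>; the factor \<open>E\<close> of the
      inequality for \<open>W\<close> cancels the denominator.\<close>
  have "- (m / E) \<le> w (y, t)" for y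
    using m[OF slice(2)[of y]] \<open>0 < E\<close> by (simp add: W_slice field_simps)
  moreover have "w (z, t) \<le> 0"
    using \<open>W q < 0\<close> \<open>0 < E\<close> by (simp add: zt W_slice mult_less_0_iff)
  ultimately have "?L2 + ?L1 - wt (z, t) \<le> C * (m / E)"
    by (intro supersolution[OF qT])
  then have "E * (?L2 + ?L1 - wt (z, t)) \<le> E * (C * (m / E))"
    using \<open>0 < E\<close> by (intro mult_left_mono) auto
  also have "E * (C * (m / E)) = C * m"
    using \<open>0 < E\<close> by simp
  finally have "E * ?L2 + E * ?L1 - E * wt (z, t) \<le> C * m"
    by (simp only: distrib_left right_diff_distrib)
  with second first penalty time have "- \<epsilon> * (K * \<psi> z) - C * m \<le> \<mu> * W q"
    by (simp add: algebra_simps)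
  moreover have "\<mu> * W q \<le> \<mu> * (- m / 2 - \<epsilon> * \<psi> z)"
    using neg \<open>0 \<le> K\<close> C by (intro mult_left_mono) (auto simp: \<mu>_def)
  ultimately have "- \<epsilon> * (K * \<psi> z) - C * m \<le> \<mu> * (- m / 2 - \<epsilon> * \<psi> z)"
    by linarith
  then have "K * m / 2 + m / 2 + 2 * (C * (\<epsilon> * \<psi> z)) + \<epsilon> * \<psi> z \<le> 0"
    by (simp add: \<mu>_def algebra_simps)
  moreover have "0 \<le> K * m" "0 \<le> C * (\<epsilon> * \<psi> z)"
    using \<open>0 \<le> K\<close> \<open>0 < m\<close> C \<open>0 < \<epsilon> * \<psi> z\<close> by simp_all
  ultimately show False
    using \<open>0 < m\<close> \<open>0 < \<epsilon> * \<psi> z\<close> by linarith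
qed

section \<open>The comparison theorem\<close>

lemma C21_derivatives:
  assumes "u \<in> C21 T" and "(x, t) \<in> cyl T"
  shows "((\<lambda>s. u (x + s *\<^sub>R axis i 1, t)) has_real_derivative dx i u (x, t)) (at 0)"
    and "((\<lambda>s. dx j u (x + s *\<^sub>R axis i 1, t)) has_real_derivative dx i (dx j u) (x, t)) (at 0)"
    and "((\<lambda>s. u (x, s)) has_real_derivative dt T u (x, t)) (at t within {0<..T})"
proof -
  have "has_dx_on i u (cyl T)" "has_dx_on i (dx j u) (cyl T)" "has_dt_on_cyl T u"
    using assms(1) by (auto simp: C21_def)
  then have "(\<lambda>s. u (x + s *\<^sub>R axis i 1, t)) differentiable (at 0)"
    and "(\<lambda>s. dx j u (x + s *\<^sub>R axis i 1, t)) differentiable (at 0)"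
    and "(\<lambda>s. u (x, s)) differentiable (at t within {0<..T})"
    using assms(2) unfolding has_dx_on_def has_dt_on_cyl_def by auto
  then show "((\<lambda>s. u (x + s *\<^sub>R axis i 1, t)) has_real_derivative dx i u (x, t)) (at 0)"
    and "((\<lambda>s. dx j u (x + s *\<^sub>R axis i 1, t)) has_real_derivative dx i (dx j u) (x, t)) (at 0)"
    and "((\<lambda>s. u (x, s)) has_real_derivative dt T u (x, t)) (at t within {0<..T})"
    unfolding dx_def dt_def has_real_derivative_iff_has_vector_derivative
    by (simp_all add: DERIV_deriv_iff_real_differentiable vector_derivative_works
        flip: has_real_derivative_iff_has_vector_derivative)
qed

theorem theorem4p4:
  fixes T \<alpha> :: real
    and a :: "'n::finite \<Rightarrow> 'n \<Rightarrow> (real^'n) \<times> real \<Rightarrow> real"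
    and b :: "'n \<Rightarrow> (real^'n) \<times> real \<Rightarrow> real"
    and f :: "real^'n \<Rightarrow> real \<Rightarrow> real \<Rightarrow> real \<Rightarrow> real"
    and \<phi> :: "real^'n \<Rightarrow> real"
    and u_upper u_lower :: "(real^'n) \<times> real \<Rightarrow> real"
  assumes T: "0 < T"
    and alpha: "0 < \<alpha>" "\<alpha> \<le> 1"
    and a_reg: "\<And>i j. a i j \<in> L_infty (closed_cyl T) \<inter> H_space \<alpha> (closed_cyl T)"
    and b_reg: "\<And>i. b i \<in> L_infty (closed_cyl T) \<inter> H_space \<alpha> (closed_cyl T)"
    and a_sym: "\<And>i j p. p \<in> cyl T \<Longrightarrow> a i j p = a j i p"
    and elliptic: "\<exists>Amin>0. \<exists>Amax>0. \<forall>p\<in>closed_cyl T. \<forall>\<eta>::real^'n.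
          Amin * (norm \<eta>)\<^sup>2 \<le> (\<Sum>i\<in>UNIV. \<Sum>j\<in>UNIV. a i j p * \<eta> $ i * \<eta> $ j) \<and>
          (\<Sum>i\<in>UNIV. \<Sum>j\<in>UNIV. a i j p * \<eta> $ i * \<eta> $ j) \<le> Amax * (norm \<eta>)\<^sup>2"
    and a_hoelder: "\<exists>k>0. \<forall>i j. \<forall>(x1, t1)\<in>closed_cyl T. \<forall>(x2, t2)\<in>closed_cyl T.
          \<bar>a i j (x1, t1) - a i j (x2, t2)\<bar>
            \<le> k * (norm (x1 - x2) powr \<alpha> + \<bar>t1 - t2\<bar> powr (\<alpha> / 2))"
    and a_dx: "\<And>i j k. has_dx_on k (a i j) (closed_cyl T) \<and>
          dx k (a i j) \<in> L_infty (closed_cyl T) \<inter> H_space \<alpha> (closed_cyl T)"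
    and a_dxx: "\<And>i j k l. has_dx_on k (dx l (a i j)) (closed_cyl T) \<and>
          dx k (dx l (a i j)) \<in> L_infty (closed_cyl T) \<inter> H_space \<alpha> (closed_cyl T)"
    and b_dx: "\<And>i k. has_dx_on k (b i) (closed_cyl T) \<and>
          dx k (b i) \<in> L_infty (closed_cyl T) \<inter> H_space \<alpha> (closed_cyl T)"
    and phi: "integrable lebesgue \<phi>" "\<And>x. 0 \<le> \<phi> x"
    and upper: "continuous_on (closed_cyl T) u_upper" "u_upper \<in> C21 T \<inter> L_infty (closed_cyl T)"
    and lower: "continuous_on (closed_cyl T) u_lower" "u_lower \<in> C21 T \<inter> L_infty (closed_cyl T)"
    and f_mono: "nondecreasing_in_v (cyl T) (K_rect T \<phi> u_upper u_lower) f"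
    and f_lip_u: "lipschitz_in_u (cyl T) (K_rect T \<phi> u_upper u_lower) f"
    and f_lip_v: "lipschitz_in_v (cyl T) (K_rect T \<phi> u_upper u_lower) f"
    and P_le: "\<And>p. p \<in> cyl T \<Longrightarrow> P_op T a b f \<phi> u_upper p \<le> P_op T a b f \<phi> u_lower p"
    and boundary: "\<And>p. p \<in> parabolic_boundary \<Longrightarrow> u_lower p \<le> u_upper p"
  shows "\<forall>p\<in>closed_cyl T. u_lower p \<le> u_upper p"
proof
  fix p :: "(real^'n) \<times> real"
  assume p: "p \<in> closed_cyl T"
  have cyl_closed: "q \<in> cyl T \<Longrightarrow> q \<in> closed_cyl T" for q :: "(real^'n) \<times> real"
    by (auto simp: cyl_def closed_cyl_def)
  have u: "u_upper \<in> C21 T" "u_upper \<in> L_infty (closed_cyl T)"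
    and v: "u_lower \<in> C21 T" "u_lower \<in> L_infty (closed_cyl T)"
    using upper(2) lower(2) by auto
  obtain c where c: "0 < c" "\<And>q (\<eta>::real^'n). q \<in> closed_cyl T \<Longrightarrow>
      c * (norm \<eta>)\<^sup>2 \<le> (\<Sum>i\<in>UNIV. \<Sum>j\<in>UNIV. a i j q * \<eta> $ i * \<eta> $ j)"
    using elliptic by blast
  obtain B where B: "\<And>i q. q \<in> closed_cyl T \<Longrightarrow> \<bar>a i i q\<bar> \<le> B" "\<And>i q. q \<in> closed_cyl T \<Longrightarrow> \<bar>b i q\<bar> \<le> B"
  proof -
    have "bounded (\<Union>i. a i i ` closed_cyl T \<union> b i ` closed_cyl T)"
      using a_reg b_reg by (auto simp: L_infty_def)
    then obtain B where "\<forall>r\<in>(\<Union>i. a i i ` closed_cyl T \<union> b i ` closed_cyl T). norm r \<le> B"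
      unfolding bounded_iff by blast
    then show ?thesis
      by (intro that[of B]) auto
  qed
  obtain C where C: "0 \<le> C" "\<And>x t d. (x, t) \<in> cyl T \<Longrightarrow> u_upper (x, t) \<le> u_lower (x, t) \<Longrightarrow>
      (\<And>y. - d \<le> u_upper (y, t) - u_lower (y, t)) \<Longrightarrow>
      - C * d \<le> f x t (u_upper (x, t)) (J_op \<phi> u_upper (x, t)) - f x t (u_lower (x, t)) (J_op \<phi> u_lower (x, t))"
    using reaction_difference_lower_bound[OF phi upper(1) u(2) lower(1) v(2) f_mono f_lip_u f_lip_v] by blast
  have "0 \<le> u_upper p - u_lower p"
  proof (rule nonlocal_maximum_principle[where
        w = "\<lambda>q. u_upper q - u_lower q" and wt = "\<lambda>q. dt T u_upper q - dt T u_lower q" and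
        D = "\<lambda>i q. dx i u_upper q - dx i u_lower q" and
        H = "\<lambda>i j q. dx i (dx j u_upper) q - dx i (dx j u_lower) q" and
        a = a and b = b and T = T and c = c and B = B and C = C])
    fix x :: "real^'n" and t d
    assume xt: "(x, t) \<in> cyl T" and "u_upper (x, t) - u_lower (x, t) \<le> 0"
      and "\<And>y. - d \<le> u_upper (y, t) - u_lower (y, t)"
    then have "- C * d \<le> f x t (u_upper (x, t)) (J_op \<phi> u_upper (x, t)) - f x t (u_lower (x, t)) (J_op \<phi> u_lower (x, t))"
      by (intro C(2)) auto
    with P_le[OF xt]
    show "(\<Sum>i\<in>UNIV. \<Sum>j\<in>UNIV. a i j (x, t) * (dx i (dx j u_upper) (x, t) - dx i (dx j u_lower) (x, t)))
        + (\<Sum>i\<in>UNIV. b i (x, t) * (dx i u_upper (x, t) - dx i u_lower (x, t)))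
        - (dt T u_upper (x, t) - dt T u_lower (x, t)) \<le> C * d"
      by (simp add: P_op_def right_diff_distrib sum_subtractf)
  next
    show "(\<lambda>q. u_upper q - u_lower q) \<in> L_infty (closed_cyl T)"
      using u(2) v(2) by (auto simp: L_infty_def intro: bounded_minus_comp)
  next
    show "0 \<le> u_upper (x, 0) - u_lower (x, 0)" for x
      using boundary[of "(x, 0)"] by (simp add: parabolic_boundary_def)
  next
    show "continuous_on (cyl T) (\<lambda>q. dx i u_upper q - dx i u_lower q)"
      and "continuous_on (cyl T) (\<lambda>q. dx i (dx j u_upper) q - dx i (dx j u_lower) q)" for i j
      using u(1) v(1) by (auto simp: C21_def intro!: continuous_intros)
  qed (use a_sym c B C(1) p upper(1) lower(1) cyl_closed in
      \<open>auto intro!: continuous_intros DERIV_diff C21_derivatives[OF u(1)] C21_derivatives[OF v(1)]\<close>)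
  then show "u_lower p \<le> u_upper p"
    by simp
qed

end
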